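(* Let $n,k$ be positive integers with $k\ge 3$. Each tree $T$ with order $n$ and maximum degree $k$ satisfies $$d(CT(T),C(T))\le \left\lfloor\frac{n-\left\lceil\frac{n+1}{2}\right\rceil-h_u}{2}\right\rfloor,\qquad\text{where}\qquad h_u=\left\lceil\frac{\ln\left(\left\lceil\frac{n+1}{2}\right\rceil(k-2)+1\right)}{\ln(k-1)}\right\rceil-1 .$$ This inequality is tight for the tree (of order $n$) formed by identifying the root of an extended rgood tree (of maximum degree $k$) with one end of a path of appropriate length.
   Context: For vertices $u,v$ of a tree $T$, $d(u,v)$ is the number of edges on the unique path joining them. The eccentricity of $v$ is $ecc_T(v)=\max_{u\in V(T)}d(v,u)$, and the center $C(T)$ is the set of vertices of minimum eccentricity. The distance of $v$ is $d_T(v)=\sum_{u\in V(T)}d(v,u)$, and the centroid $CT(T)$ is the set of vertices minimizing $d_T$. For vertex sets $S,S'$, $d(S,S')=\min\{d(u,v):u\in S,\ v\in S'\}$. Rooted greedy tree: given a tree degree sequence in non-increasing order with one entry distinguished as the root degree, let $d'_1\ge d'_2\ge\dots$ be the sequence with that entry removed. The rooted greedy tree has a root of the distinguished degree; the children of the root receive, from left to right, the degrees $d'_1,d'_2,\dots$; then, level by level, the vertices of a level are processed from left to right, each non-root vertex of degree $d$ being joined to the next $d-1$ vertices of the following level, and the vertices of the following level receive, from left to right, the next largest unused entries in non-increasing order. Extended rgood tree with order $m$ and maximum degree $k$: the rooted greedy tree on $m$ vertices with root degree $k-1$ and degree sequence $(k,k,\dots,k,k-1,s,1,\dots,1)$ for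 some $1\le s<k$. *)

theory Defs
  imports Complex_Main "Graph_Theory.Graph_Theory"
begin

section \<open>Trees and their middle parts\<close>

text \<open>
  A finite simple undirected graph is a \<^locale>\<open>pair_graph\<close>, i.e. a finite, loop-free, symmetric
  set of arcs.  In such a graph the closed walk \<open>a, b, a\<close> along a single edge counts as a
  \<^const>\<open>pre_digraph.cycle\<close>, so the library's \<^const>\<open>tree\<close> is not the notion of a tree for
  undirected graphs; only cycles of length at least 3 must be excluded.
\<close>

definition utree :: "'a pair_pre_digraph \<Rightarrow> bool" where
  "utree G \<longleftrightarrow> pair_graph G \<and> Digraph_Component.connected (with_proj G) \<and>
     \<not> (\<exists>p. pre_digraph.cycle (with_proj G) p \<and> 3 \<le> length p)"

definition order :: "'a pair_pre_digraph \<Rightarrow> nat" where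
  "order G = card (pverts G)"

text \<open>By symmetry the degree of a vertex is its \<^const>\<open>out_degree\<close>.\<close>

definition max_degree :: "'a pair_pre_digraph \<Rightarrow> nat" where
  "max_degree G = Max (out_degree (with_proj G) ` pverts G)"

definition tdist :: "'a pair_pre_digraph \<Rightarrow> 'a \<Rightarrow> 'a \<Rightarrow> nat" where
  "tdist G u v = length (THE p. pre_digraph.apath (with_proj G) u p v)"

definition ecc :: "'a pair_pre_digraph \<Rightarrow> 'a \<Rightarrow> nat" where
  "ecc G v = Max ((\<lambda>u. tdist G v u) ` pverts G)"

definition center :: "'a pair_pre_digraph \<Rightarrow> 'a set" where
  "center G = {v \<in> pverts G. \<forall>w \<in> pverts G. ecc G v \<le> ecc G w}"

definition vertex_dist :: "'a pair_pre_digraph \<Rightarrow> 'a \<Rightarrow> nat" where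
  "vertex_dist G v = (\<Sum>u \<in> pverts G. tdist G v u)"

definition centroid :: "'a pair_pre_digraph \<Rightarrow> 'a set" where
  "centroid G = {v \<in> pverts G. \<forall>w \<in> pverts G. vertex_dist G v \<le> vertex_dist G w}"

definition set_tdist :: "'a pair_pre_digraph \<Rightarrow> 'a set \<Rightarrow> 'a set \<Rightarrow> nat" where
  "set_tdist G S S' = Min {tdist G u v | u v. u \<in> S \<and> v \<in> S'}"


section \<open>Rooted greedy trees\<close>

text \<open>
  \<open>ds\<close> is a tree degree sequence in non-increasing order and \<open>r\<close> the entry distinguished as the
  root degree.  The vertices are numbered level by level and from left to right, starting with the
  root \<open>0\<close>.  The remaining degrees are handed out in exactly this order, so vertex \<open>i > 0\<close> has
  degree \<open>d'\<^sub>i\<close>, which is \<open>remove1 r ds ! (i - 1)\<close>.  As every vertex is joined to the next unused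
  vertices of the following level, the children of \<open>i\<close> are the consecutive numbers that follow
  the children of \<open>0, \<dots>, i - 1\<close>.
\<close>

definition greedy_children :: "nat list \<Rightarrow> nat \<Rightarrow> nat \<Rightarrow> nat" where
  "greedy_children ds r i = (if i = 0 then r else remove1 r ds ! (i - 1) - 1)"

definition greedy_first_child :: "nat list \<Rightarrow> nat \<Rightarrow> nat \<Rightarrow> nat" where
  "greedy_first_child ds r i = 1 + (\<Sum>j<i. greedy_children ds r j)"

definition greedy_edges :: "nat list \<Rightarrow> nat \<Rightarrow> nat rel" where
  "greedy_edges ds r = {(i, j). i < length ds \<and>
     greedy_first_child ds r i \<le> j \<and> j < greedy_first_child ds r i + greedy_children ds r i}"

definition rooted_greedy_tree :: "nat list \<Rightarrow> nat \<Rightarrow> nat pair_pre_digraph" where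
  "rooted_greedy_tree ds r =
     \<lparr> pverts = {..<length ds}, parcs = greedy_edges ds r \<union> (greedy_edges ds r)\<inverse> \<rparr>"

text \<open>
  The condition on the sum says that \<open>ds\<close> is the degree sequence of a tree on \<open>m\<close> vertices.
  Either of the blocks of entries \<open>k\<close> and \<open>1\<close> may be empty as far as that condition permits.
\<close>

definition extended_rgood :: "nat \<Rightarrow> nat \<Rightarrow> nat pair_pre_digraph \<Rightarrow> bool" where
  "extended_rgood m k R \<longleftrightarrow> (\<exists>a b s ds. 1 \<le> s \<and> s < k \<and>
     ds = replicate a k @ [k - 1, s] @ replicate b 1 \<and>
     length ds = m \<and> sum_list ds = 2 * (m - 1) \<and>
     R = rooted_greedy_tree ds (k - 1))"

text \<open>
  Identify the vertex \<open>0\<close> of a graph on the vertices \<open>0, \<dots>, m - 1\<close> with one end of a path with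
  \<open>l\<close> edges; \<open>path_vertex m i\<close> is the \<open>i\<close>-th vertex of that path.
\<close>

definition path_vertex :: "nat \<Rightarrow> nat \<Rightarrow> nat" where
  "path_vertex m i = (if i = 0 then 0 else m + i - 1)"

definition path_edges :: "nat \<Rightarrow> nat \<Rightarrow> nat rel" where
  "path_edges m l = {(path_vertex m i, path_vertex m (Suc i)) | i. i < l}"

definition attach_path :: "nat pair_pre_digraph \<Rightarrow> nat \<Rightarrow> nat pair_pre_digraph" where
  "attach_path R l =
     \<lparr> pverts = pverts R \<union> path_vertex (order R) ` {..l},
       parcs = parcs R \<union> path_edges (order R) l \<union> (path_edges (order R) l)\<inverse> \<rparr>"


section \<open>The bound\<close>

definition half_order :: "nat \<Rightarrow> int" where
  "half_order n = \<lceil>(real n + 1) / 2\<rceil>"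

definition h_u :: "nat \<Rightarrow> nat \<Rightarrow> int" where
  "h_u n k = \<lceil>ln (real_of_int (half_order n) * (real k - 2) + 1) / ln (real k - 1)\<rceil> - 1"

definition center_centroid_bound :: "nat \<Rightarrow> nat \<Rightarrow> int" where
  "center_centroid_bound n k = \<lfloor>real_of_int (int n - half_order n - h_u n k) / 2\<rfloor>"

end

theory Submission
  imports Defs
begin

text \<open>
  Write \<open>m = n div 2 + 1\<close> for the half order, \<open>q = k - 1\<close> and \<open>H = h_u n k\<close>.  The logarithm in the
  definition of \<open>H\<close> encodes that \<open>H\<close> is the least height at which a rooted tree with at most \<open>q\<close>
  children per vertex can have \<open>m\<close> vertices: \<open>\<Sum>i<H. q ^ i < m \<le> \<Sum>i\<le>H. q ^ i\<close>
  (\<open>h_u_characterization\<close>).  The bound is thus \<open>(n - m - H) div 2\<close>.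

  \<^bold>\<open>Upper bound.\<close>  Let \<open>u\<close> in the centroid and \<open>v\<close> in the center be at minimal distance \<open>D > 0\<close>, and
  let \<open>u'\<close> and \<open>v'\<close> be the neighbours of \<open>u\<close> and \<open>v\<close> on the path between them.  Passing from \<open>u\<close> to
  \<open>u'\<close> changes the sum of distances by the difference in size of the two components left when the
  edge \<open>uu'\<close> is deleted.  As \<open>u'\<close> is not in the centroid, the component of \<open>u\<close> has at
  least \<open>m\<close> vertices and that of \<open>u'\<close> at most \<open>n - m\<close>.  In the former \<open>u\<close> has lost a neighbour, so
  it contains a vertex \<open>w\<close> at distance at least \<open>H\<close> from \<open>u\<close>, and hence \<open>D + H \<le> ecc v\<close>.  As \<open>v'\<close> is
  not in the center, some vertex \<open>x\<close> at distance \<open>ecc v\<close> from \<open>v\<close> lies beyond \<open>v\<close> as seen from \<open>u\<close>.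
  The path from \<open>u\<close> to \<open>x\<close> has \<open>D + ecc v\<close> vertices after \<open>u\<close>, all of them in the component of \<open>u'\<close>.
  So \<open>2 * D + H \<le> D + ecc v \<le> n - m\<close> (\<open>centroid_center_dist_le\<close>).
  For \<open>D = 0\<close> only \<open>H \<le> n - m\<close> is needed, which holds because \<open>n > k \<ge> 3\<close> (\<open>height_le\<close>).

  \<^bold>\<open>Tightness.\<close>  An extended rgood tree is a \<open>q\<close>-ary tree filled level by level, in which the parent
  of \<open>j\<close> is \<open>(j - 1) div q\<close>; its height is therefore at most \<open>H\<close>.  After attaching a path with
  \<open>l = n - m\<close> edges at the root, every branch at the root has fewer than \<open>n / 2\<close> vertices, so the root is the whole
  centroid.  A vertex \<open>v\<close> closer to the root than \<open>(l - H) div 2\<close> is too far from the free end of the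
  path: the vertex of the path at distance \<open>(l - H) div 2\<close> from the root has smaller eccentricity.
  So the center is at least that far away (\<open>center_far\<close>).

  Apart from being symmetric and vanishing exactly on the diagonal, the distance of a tree enters
  the argument only through two facts: it changes by exactly one along an edge (\<open>dist_adjacent\<close>),
  and each vertex has exactly one neighbour that is closer to a given other vertex (\<open>ex_closer\<close>,
  \<open>closer_unique\<close>).
\<close>

section \<open>Uniqueness of paths in acyclic graphs\<close>

lemma length_rev_path [simp]: "length (rev_path p) = length p"
  by (induction p) auto

text \<open>
  If two paths from \<open>u\<close> to \<open>v\<close> start with different arcs, follow the first one up to the first vertex
  \<open>z\<close> that also lies on the second one, and return from there along the second one.  This closes a
  cycle; it has length at least 3, for otherwise both paths would start with the arc from \<open>u\<close> to \<open>z\<close>.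
\<close>
lemma (in pair_graph) apath_unique_if_acyclic:
  assumes acyclic: "\<not> (\<exists>c. cycle c \<and> 3 \<le> length c)"
    and "apath u p v" "apath u q v"
  shows "p = q"
  using assms(2,3)
proof (induction p arbitrary: u q)
  case Nil
  then show ?case
    by (metis apath_Nil_iff apath_nonempty_ends)
next
  case (Cons e p)
  have "q \<noteq> []"
    using Cons.prems apath_nonempty_ends[of u "e # p" v] by (auto simp: apath_Nil_iff)
  then obtain f q' where q: "q = f # q'"
    by (cases q) auto
  have e: "e \<in> parcs G" "fst e = u" "apath (snd e) p v" "u \<notin> set (awalk_verts (snd e) p)"
    using Cons.prems(1) by (auto simp: apath_Cons_iff)
  have f: "f \<in> parcs G" "fst f = u" "apath (snd f) q' v" "u \<notin> set (awalk_verts (snd f) q')"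
    using Cons.prems(2) by (auto simp: apath_Cons_iff q)
  show ?case
  proof (cases "e = f")
    case True
    then show ?thesis using Cons.IH e f q by auto
  next
    case False
    have v_in: "v \<in> set (awalk_verts (snd e) p)" "v \<in> set (awalk_verts (snd f) q')"
      using e(3) f(3) by (metis apath_def awalkE' awalk_verts_non_Nil last_in_set)+
    obtain ys z zs where ys: "awalk_verts (snd e) p = ys @ z # zs"
        "z \<in> set (awalk_verts (snd f) q')" "\<forall>y \<in> set ys. y \<notin> set (awalk_verts (snd f) q')"
      using split_list_first_prop[of "awalk_verts (snd e) p" "\<lambda>x. x \<in> set (awalk_verts (snd f) q')"] v_in
      by blast
    obtain ys' zs' where ys': "awalk_verts (snd f) q' = ys' @ z # zs'"
      using ys(2) split_list by fast
    have aw: "awalk (snd e) p v" "awalk (snd f) q' v"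
      using e(3) f(3) by (auto simp: apath_def)
    then have c: "pcas (snd e) p v" "pcas (snd f) q' v" by auto
    obtain p1 p2 where p1: "pcas (snd e) p1 z" "p = p1 @ p2" "awalk_verts (snd e) p1 = ys @ [z]"
      using awalk_decomp_verts[OF c(1) ys(1)] by metis
    obtain q1 q2 where q1: "pcas (snd f) q1 z" "q' = q1 @ q2" "awalk_verts (snd f) q1 = ys' @ [z]"
      using awalk_decomp_verts[OF c(2) ys'] by metis
    have w1: "awalk (snd e) p1 z" using aw(1) p1 by simp
    have w2: "awalk u (f # q1) z" using aw(2) q1 f by (auto simp: awalk_Cons_iff)
    let ?c = "e # p1 @ rev_path (f # q1)"
    have w3: "awalk (snd e) (p1 @ rev_path (f # q1)) u"
      using awalk_appendI[OF w1 awalk_rev_path'[OF w2]] .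
    then have w: "awalk u ?c u"
      using e by (auto simp: awalk_Cons_iff)
    have "awalk_verts z (rev_path (f # q1)) = z # rev ys' @ [u]"
      using awalk_verts_rev_path[OF w2] q1(3) f(2) by simp
    then have verts: "tl (awalk_verts u ?c) = ys @ z # rev ys' @ [u]"
      using awalk_verts_append[OF w3] p1(3) by simp
    have "distinct (ys @ z # zs)" "distinct (ys' @ z # zs')"
      using e(3) f(3) ys(1) ys' by (auto simp: apath_def)
    then have "distinct (tl (awalk_verts u ?c))"
      using ys(3) ys' ys(1) e(4) f(4) unfolding verts by auto
    then have "cycle ?c" using w by (auto simp: cycle_def)
    moreover have "3 \<le> length ?c"
    proof (rule ccontr)
      assume "\<not> 3 \<le> length ?c"
      moreover have "length ?c = length p1 + length q1 + 2" by simp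
      ultimately have "length p1 = 0" "length q1 = 0" by linarith+
      then have "p1 = []" "q1 = []" by simp_all
      then have "snd e = snd f" using p1(1) q1(1) by simp
      then show False using False e f by (auto simp: prod_eq_iff)
    qed
    ultimately show ?thesis using acyclic by blast
  qed
qed

section \<open>Distances in trees\<close>

locale undirected_tree =
  fixes T :: "'a pair_pre_digraph"
  assumes utree: "utree T"

sublocale undirected_tree \<subseteq> pair_graph T
  using utree by (simp add: utree_def)

context undirected_tree
begin

abbreviation V :: "'a set" where "V \<equiv> pverts T"
abbreviation d :: "'a \<Rightarrow> 'a \<Rightarrow> nat" where "d \<equiv> tdist T"

lemma verts_nonempty: "V \<noteq> {}"
  using utree by (auto simp: utree_def connected_conv)

lemma ex_apath:
  assumes "u \<in> V" "v \<in> V"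
  obtains p where "apath u p v"
proof -
  have "strongly_connected T"
    using utree by (intro symmetric_connected_imp_strongly_connected sym_arcs) (simp add: utree_def)
  then have "u \<rightarrow>\<^sup>*\<^bsub>T\<^esub> v"
    using assms by (auto simp: strongly_connected_def)
  then show ?thesis
    using that by (auto simp: reachable_apath)
qed

lemma apath_unique: "apath u p v \<Longrightarrow> apath u q v \<Longrightarrow> p = q"
  using apath_unique_if_acyclic utree unfolding utree_def by blast

lemma dist_eq_length: "apath u p v \<Longrightarrow> d u v = length p"
  unfolding tdist_def using apath_unique by (metis the_equality)

lemma dist_commute:
  assumes "u \<in> V" "v \<in> V"
  shows "d u v = d v u"
proof -
  obtain p where "apath u p v" using ex_apath assms by blast
  then show ?thesis
    using dist_eq_length[of u p v] dist_eq_length[of v "rev_path p" u] by simp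
qed

lemma dist_eq_0_iff:
  assumes "u \<in> V" "v \<in> V"
  shows "d u v = 0 \<longleftrightarrow> u = v"
proof -
  obtain p where p: "apath u p v" using ex_apath assms by blast
  then show ?thesis
    using dist_eq_length[OF p] apath_nonempty_ends[OF p] by (auto simp: apath_Nil_iff)
qed

lemma dist_self: "u \<in> V \<Longrightarrow> d u u = 0"
  using dist_eq_0_iff by blast

text \<open>
  If \<open>b\<close> lies on the path from \<open>a\<close> to \<open>x\<close>, uniqueness forces this path to start with the edge to \<open>b\<close>;
  otherwise putting the edge in front of it gives the path from \<open>b\<close>.
\<close>
lemma adjacent_cases:
  assumes "(a, b) \<in> parcs T" "x \<in> V"
  obtains (away) p where "apath a p x" "apath b ((b, a) # p) x"
    | (toward) p where "apath b p x" "apath a ((a, b) # p) x"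
proof -
  have a: "a \<in> V" "(b, a) \<in> parcs T" "a \<noteq> b"
    using assms in_arcsD1 arcs_symmetric no_loops' by auto
  obtain p where p: "apath a p x" using ex_apath a assms by blast
  show ?thesis
  proof (cases "b \<in> set (awalk_verts a p)")
    case False
    then have "apath b ((b, a) # p) x" using a p by (auto simp: apath_Cons_iff)
    then show ?thesis using away p by blast
  next
    case True
    then obtain q r where qr: "p = q @ r" "awalk a q b" "awalk b r x"
      using p awalk_decomp by (metis apath_def)
    have last: "last (awalk_verts a q) = b"
      using qr(2) by auto
    have q: "apath a q b" "apath b r x"
      using p last unfolding qr(1) apath_append_iff by auto
    have "apath a [(a, b)] b"
      using a assms in_arcsD2 by (auto simp: apath_simps)
    then have "q = [(a, b)]" using apath_unique q by blast
    then show ?thesis using toward q p qr by auto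
  qed
qed

lemma dist_adjacent:
  assumes "(a, b) \<in> parcs T" "x \<in> V"
  shows "d b x = Suc (d a x) \<or> d a x = Suc (d b x)"
  using assms by (cases rule: adjacent_cases) (auto dest!: dist_eq_length)

lemma ex_closer:
  assumes "y \<in> V" "x \<in> V" "y \<noteq> x"
  obtains a where "(y, a) \<in> parcs T" "a \<in> V" "d y x = Suc (d a x)"
proof -
  obtain p where p: "apath y p x" using ex_apath assms by blast
  then obtain e p' where "p = e # p'"
    using assms by (cases p) (auto simp: apath_Nil_iff)
  then have "(y, snd e) \<in> parcs T" "apath (snd e) p' x" "d y x = Suc (length p')"
    using p dist_eq_length[OF p] by (auto simp: apath_Cons_iff)
  then show ?thesis
    using that dist_eq_length in_arcsD2 by metis
qed

lemma closer_unique: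
  assumes "(y, a) \<in> parcs T" "(y, b) \<in> parcs T" "x \<in> V" "d a x < d y x" "d b x < d y x"
  shows "a = b"
proof -
  have first: "\<exists>p. apath y ((y, c) # p) x" if c: "(y, c) \<in> parcs T" "d c x < d y x" for c
    using c(1) assms(3)
  proof (cases rule: adjacent_cases)
    case (away p)
    then have "d c x = Suc (d y x)" by (auto dest!: dist_eq_length)
    then show ?thesis using c by simp
  qed auto
  show ?thesis
    using first[of a] first[of b] assms apath_unique by blast
qed

lemma dist_triangle:
  assumes "u \<in> V" "v \<in> V" "w \<in> V"
  shows "d u w \<le> d u v + d v w"
  using assms
proof (induction "d u v" arbitrary: u)
  case 0
  then show ?case using dist_eq_0_iff by auto
next
  case (Suc i)
  then have "u \<noteq> v" using dist_self by force
  then obtain a where a: "(u, a) \<in> parcs T" "a \<in> V" "d u v = Suc (d a v)"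
    using ex_closer Suc by metis
  then have "d a w \<le> d a v + d v w" using Suc by auto
  then show ?case using a dist_adjacent[OF a(1) Suc.prems(3)] by auto
qed

section \<open>Degrees\<close>

abbreviation degree :: "'a \<Rightarrow> nat" where "degree \<equiv> out_degree (with_proj T)"

lemma degree_eq: "degree v = card {w. (v, w) \<in> parcs T}"
proof -
  have "out_arcs (with_proj T) v = Pair v ` {w. (v, w) \<in> parcs T}"
    by (auto simp: out_arcs_def)
  then show ?thesis
    unfolding out_degree_def by (simp add: card_image inj_on_def)
qed

lemma finite_neighbours: "finite {w. (v, w) \<in> parcs T}"
  using finite_subset[OF _ finite_verts, of "{w. (v, w) \<in> parcs T}"] in_arcsD2 by auto

lemma degree_le_max_degree: "v \<in> V \<Longrightarrow> degree v \<le> max_degree T"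
  unfolding max_degree_def using finite_verts by (intro Max_ge) auto

lemma max_degree_less_order: "max_degree T < order T"
proof -
  have "max_degree T \<in> degree ` V"
    unfolding max_degree_def using finite_verts verts_nonempty by (intro Max_in) auto
  then obtain v where v: "v \<in> V" "max_degree T = card {w. (v, w) \<in> parcs T}"
    by (auto simp: degree_eq)
  note v(2)
  also have "card {w. (v, w) \<in> parcs T} \<le> card (V - {v})"
    using in_arcsD2 no_loops' finite_verts by (intro card_mono) auto
  also have "\<dots> < order T"
    using card_Diff1_less[OF finite_verts v(1)] by (simp add: order_def)
  finally show ?thesis .
qed

section \<open>The two sides of an edge\<close>

text \<open>For an arc \<open>(a, b)\<close> this is the component of \<open>a\<close> after deletion of the edge between \<open>a\<close> and \<open>b\<close>.\<close>
definition side :: "'a \<Rightarrow> 'a \<Rightarrow> 'a set" where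
  "side a b = {x \<in> V. d a x < d b x}"

lemma finite_side [simp]: "finite (side a b)"
  using finite_verts by (simp add: side_def)

lemma in_sideD: "x \<in> side a b \<Longrightarrow> x \<in> V"
  by (simp add: side_def)

lemma side_dist: "(a, b) \<in> parcs T \<Longrightarrow> x \<in> side a b \<Longrightarrow> d b x = Suc (d a x)"
  using dist_adjacent[of a b x] by (auto simp: side_def)

lemma not_side_iff: "(a, b) \<in> parcs T \<Longrightarrow> x \<in> V \<Longrightarrow> x \<notin> side a b \<longleftrightarrow> x \<in> side b a"
  using dist_adjacent[of a b x] by (auto simp: side_def)

lemma side_Un: "(a, b) \<in> parcs T \<Longrightarrow> side a b \<union> side b a = V"
  using not_side_iff in_sideD by blast

lemma side_Int: "side a b \<inter> side b a = {}"
  by (auto simp: side_def)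

lemma card_side_add: "(a, b) \<in> parcs T \<Longrightarrow> card (side a b) + card (side b a) = card V"
  using card_Un_disjoint[of "side a b" "side b a"] side_Un side_Int by simp

lemma end_in_side: "(a, b) \<in> parcs T \<Longrightarrow> a \<in> side a b"
  using in_arcsD1[of a b] dist_self[of a] dist_adjacent[of a b a] by (auto simp: side_def)

text \<open>
  Moving from \<open>a\<close> to \<open>b\<close> increases the distance to each vertex on the side of \<open>a\<close> by one and decreases
  it by one on the other side.
\<close>
lemma vertex_dist_side:
  assumes "(a, b) \<in> parcs T"
  shows "vertex_dist T b + card (side b a) = vertex_dist T a + card (side a b)"
proof -
  have split: "vertex_dist T c = sum (d c) (side a b) + sum (d c) (side b a)" for c
    using sum.union_disjoint[of "side a b" "side b a" "d c"] side_Un[OF assms] side_Int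
    by (simp add: vertex_dist_def)
  have "sum (d b) (side a b) = (\<Sum>x\<in>side a b. Suc (d a x))"
    using side_dist[OF assms] by (rule sum.cong[OF refl])
  moreover have "sum (d a) (side b a) = (\<Sum>x\<in>side b a. Suc (d b x))"
    using side_dist[OF arcs_symmetric[OF assms]] by (rule sum.cong[OF refl])
  ultimately show ?thesis using split[of a] split[of b] by (simp add: sum_Suc)
qed

lemma closer_in_side:
  assumes edge: "(a, b) \<in> parcs T" and y: "y \<in> side a b" "y \<noteq> a"
  obtains w where "(y, w) \<in> parcs T" "w \<in> side a b" "d y a = Suc (d w a)"
proof -
  have V: "a \<in> V" "b \<in> V" "y \<in> V"
    using edge in_arcsD1 in_arcsD2 y in_sideD by auto
  then obtain w where w: "(y, w) \<in> parcs T" "w \<in> V" "d y a = Suc (d w a)"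
    using ex_closer y by metis
  have "d b y = Suc (d a y)" using side_dist[OF edge y(1)] .
  moreover have "d b y \<le> d b w + d w y" using dist_triangle V w by auto
  moreover have "d w y \<le> 1"
    using dist_adjacent[OF w(1) V(3)] dist_self V by auto
  ultimately have "d a w < d b w"
    using w dist_commute V by auto
  then show ?thesis using w that by (auto simp: side_def)
qed

text \<open>
  The path between vertices on different sides of an edge uses that edge.  The induction moves
  \<open>u\<close> away from \<open>c\<close>: if the distance to \<open>x\<close> decreased in a step from \<open>w\<close> to \<open>u\<close>, then \<open>u\<close> would be the
  neighbour of \<open>w\<close> closer to \<open>x\<close>, which by induction is the one closer to \<open>c\<close> (or \<open>c'\<close>, if \<open>w = c\<close>).
\<close>
lemma dist_across_edge:
  assumes edge: "(c, c') \<in> parcs T" and x: "x \<in> side c' c" and "u \<in> side c c'"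
  shows "d u x = d u c + 1 + d c' x"
  using \<open>u \<in> side c c'\<close>
proof (induction "d u c" arbitrary: u rule: less_induct)
  case less
  have V: "c \<in> V" "c' \<in> V" "x \<in> V" "u \<in> V"
    using edge in_arcsD1 in_arcsD2 x less.prems in_sideD by auto
  have cx: "d c x = Suc (d c' x)"
    using side_dist[OF arcs_symmetric[OF edge] x] .
  show ?case
  proof (cases "u = c")
    case True
    then show ?thesis using cx V dist_self by simp
  next
    case False
    obtain w where w: "(u, w) \<in> parcs T" "w \<in> side c c'" "d u c = Suc (d w c)"
      using closer_in_side edge less.prems False by blast
    have wx: "d w x = d w c + 1 + d c' x"
      using less.hyps[of w] w by simp
    have "d w x \<noteq> Suc (d u x)"
    proof
      assume u: "d w x = Suc (d u x)"
      have wu: "(w, u) \<in> parcs T" using w arcs_symmetric by blast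
      show False
      proof (cases "w = c")
        case True
        then have "u = c'"
          using closer_unique[of w u c' x] wu edge u cx V by simp
        then show False
          using less.prems end_in_side[OF arcs_symmetric[OF edge]] side_Int[of c c'] by auto
      next
        case False
        then obtain z where z: "(w, z) \<in> parcs T" "z \<in> side c c'" "d w c = Suc (d z c)"
          using closer_in_side edge w by blast
        then have "d z x = d z c + 1 + d c' x"
          using less.hyps[of z] w by simp
        then have "u = z"
          using closer_unique[of w u z x] wu z u V wx by simp
        then show False using z w by simp
      qed
    qed
    then have "d u x = Suc (d w x)"
      using dist_adjacent[OF w(1) V(3)] by auto
    then show ?thesis using wx w by simp
  qed
qed

lemma dist_arc: "(x, y) \<in> parcs T \<Longrightarrow> d x y = 1"
  using dist_adjacent[of x y y] dist_self[of y] in_arcsD2 by auto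

lemma crossing_arc:
  assumes "(a, b) \<in> parcs T" "(x, y) \<in> parcs T" "x \<in> side a b" "y \<in> side b a"
  shows "x = a \<and> y = b"
proof -
  have "d x a + 1 + d b y = 1"
    using dist_across_edge[OF assms(1,4,3)] dist_arc[OF assms(2)] by simp
  then show ?thesis
    using dist_eq_0_iff in_sideD assms in_arcsD1 in_arcsD2 by (metis add_eq_0_iff_both_eq_0 add_right_imp_eq add.commute add.assoc add_0)
qed

text \<open>The vertices of the path from \<open>x\<close> to \<open>a\<close> all lie on the side of \<open>a\<close>.\<close>
lemma dist_less_card_side:
  assumes edge: "(a, b) \<in> parcs T" and x: "x \<in> side a b"
  shows "d x a < card (side a b)"
proof -
  have "{..d x a} \<subseteq> (\<lambda>y. d y a) ` side a b"
    using x
  proof (induction "d x a" arbitrary: x)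
    case 0
    then show ?case by force
  next
    case (Suc i)
    then have "x \<noteq> a" using dist_self in_arcsD1[OF edge] by auto
    then obtain w where w: "(x, w) \<in> parcs T" "w \<in> side a b" "d x a = Suc (d w a)"
      using closer_in_side edge Suc.prems by blast
    then have "{..d w a} \<subseteq> (\<lambda>y. d y a) ` side a b" using Suc by auto
    then show ?case using imageI[OF Suc.prems, of "\<lambda>y. d y a"] by (simp add: w(3) atMost_Suc)
  qed
  then have "card {..d x a} \<le> card (side a b)"
    by (rule surj_card_le[rotated]) simp
  then show ?thesis by simp
qed

text \<open>
  All levels are measured by the distance to \<open>b\<close>, so that the root \<open>a\<close> is no exception: every
  vertex on the side of \<open>a\<close> has a neighbour closer to \<open>b\<close>, which leaves at most \<open>q\<close> children.
\<close>
lemma card_side_level: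
  assumes edge: "(a, b) \<in> parcs T" and deg: "\<And>v. v \<in> V \<Longrightarrow> degree v \<le> Suc q"
  shows "card {x \<in> side a b. d x a = i} \<le> q ^ i"
proof (induction i)
  case 0
  have "{x \<in> side a b. d x a = 0} \<subseteq> {a}"
    using in_arcsD1[OF edge] dist_eq_0_iff in_sideD by auto
  then have "card {x \<in> side a b. d x a = 0} \<le> card {a}"
    by (rule card_mono[rotated]) simp
  then show ?case by simp
next
  case (Suc i)
  let ?L = "{x \<in> side a b. d x a = i}"
  let ?F = "\<lambda>y. {x. (y, x) \<in> parcs T \<and> d x b = Suc (d y b)}"
  have V: "a \<in> V" "b \<in> V" using edge in_arcsD1 in_arcsD2 by auto
  have db: "d x b = Suc (d x a)" if "x \<in> side a b" for x
    using side_dist[OF edge that] dist_commute that in_sideD V by auto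
  have fibre: "card (?F y) \<le> q" if y: "y \<in> ?L" for y
  proof -
    have yV: "y \<in> V" using y in_sideD by auto
    have "y \<noteq> b" using db[of y] y dist_self V by auto
    then obtain z where z: "(y, z) \<in> parcs T" "d y b = Suc (d z b)"
      using ex_closer yV V by metis
    then have "card (?F y) \<le> card ({w. (y, w) \<in> parcs T} - {z})"
      by (intro card_mono) (auto simp: finite_neighbours)
    also have "\<dots> = degree y - 1"
      using z finite_neighbours by (simp add: degree_eq card_Diff_singleton)
    also have "\<dots> \<le> q" using deg[OF yV] by simp
    finally show ?thesis .
  qed
  have "{x \<in> side a b. d x a = Suc i} \<subseteq> (\<Union>y\<in>?L. ?F y)"
  proof
    fix x assume x: "x \<in> {x \<in> side a b. d x a = Suc i}"
    then have "x \<noteq> a" using dist_self V by auto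
    then obtain y where y: "(x, y) \<in> parcs T" "y \<in> side a b" "d x a = Suc (d y a)"
      using closer_in_side edge x by blast
    then have "x \<in> ?F y" using arcs_symmetric db x by auto
    then show "x \<in> (\<Union>y\<in>?L. ?F y)" using y x by auto
  qed
  then have "card {x \<in> side a b. d x a = Suc i} \<le> card (\<Union>y\<in>?L. ?F y)"
    by (rule card_mono[rotated]) (auto intro!: finite_subset[OF _ finite_neighbours])
  also have "\<dots> \<le> (\<Sum>y\<in>?L. card (?F y))"
    by (rule card_UN_le) simp
  also have "\<dots> \<le> card ?L * q"
    using sum_bounded_above[of ?L "\<lambda>y. card (?F y)" q] fibre by simp
  also have "\<dots> \<le> q ^ i * q" using Suc by simp
  finally show ?case by (simp add: mult.commute)
qed

lemma ex_far_in_side: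
  assumes edge: "(a, b) \<in> parcs T" and deg: "\<And>v. v \<in> V \<Longrightarrow> degree v \<le> Suc q"
    and large: "(\<Sum>i<H. q ^ i) < card (side a b)"
  obtains w where "w \<in> side a b" "H \<le> d w a"
proof (rule ccontr)
  assume "\<not> thesis"
  then have "side a b \<subseteq> (\<Union>i<H. {x \<in> side a b. d x a = i})"
    using that not_le by fastforce
  then have "card (side a b) \<le> card (\<Union>i<H. {x \<in> side a b. d x a = i})"
    by (rule card_mono[rotated]) simp
  also have "\<dots> \<le> (\<Sum>i<H. card {x \<in> side a b. d x a = i})"
    by (rule card_UN_le) simp
  also have "\<dots> \<le> (\<Sum>i<H. q ^ i)"
    using card_side_level[OF edge deg] by (intro sum_mono)
  finally show False using large by simp
qed

section \<open>The distance between centroid and center\<close>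

lemma dist_le_ecc: "u \<in> V \<Longrightarrow> d v u \<le> ecc T v"
  unfolding ecc_def using finite_verts by (intro Max_ge) auto

lemma ex_ecc: obtains u where "u \<in> V" "d v u = ecc T v"
proof -
  have "ecc T v \<in> (\<lambda>u. d v u) ` V"
    unfolding ecc_def using finite_verts verts_nonempty by (intro Max_in) auto
  then show ?thesis using that by auto
qed

lemma center_nonempty: "center T \<noteq> {}"
proof -
  obtain v where "v \<in> V \<and> (\<forall>w. w \<in> V \<longrightarrow> ecc T v \<le> ecc T w)"
    using ex_has_least_nat[of "\<lambda>v. v \<in> V" _ "ecc T"] verts_nonempty by auto
  then show ?thesis by (auto simp: center_def)
qed

lemma centroid_nonempty: "centroid T \<noteq> {}"
proof -
  obtain v where "v \<in> V \<and> (\<forall>w. w \<in> V \<longrightarrow> vertex_dist T v \<le> vertex_dist T w)"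
    using ex_has_least_nat[of "\<lambda>v. v \<in> V" _ "vertex_dist T"] verts_nonempty by auto
  then show ?thesis by (auto simp: centroid_def)
qed

lemma set_tdist_attained:
  obtains u v where "u \<in> centroid T" "v \<in> center T" "set_tdist T (centroid T) (center T) = d u v"
    "\<And>u' v'. u' \<in> centroid T \<Longrightarrow> v' \<in> center T \<Longrightarrow> d u v \<le> d u' v'"
proof -
  let ?D = "{d u v | u v. u \<in> centroid T \<and> v \<in> center T}"
  have "?D \<subseteq> (\<lambda>(u, v). d u v) ` (V \<times> V)"
    by (force simp: centroid_def center_def)
  then have fin: "finite ?D"
    using finite_verts by (meson finite_SigmaI finite_imageI finite_subset)
  moreover have "?D \<noteq> {}"
    using centroid_nonempty center_nonempty by auto
  ultimately have "Min ?D \<in> ?D" by (rule Min_in)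
  then obtain u v where uv: "u \<in> centroid T" "v \<in> center T" "Min ?D = d u v"
    by blast
  moreover have "d u v \<le> d u' v'" if "u' \<in> centroid T" "v' \<in> center T" for u' v'
    using Min_le[OF fin, of "d u' v'"] that unfolding uv(3) by auto
  ultimately show ?thesis
    using that unfolding set_tdist_def by blast
qed

text \<open>
  The upper bound of the theorem, with the height given by a sum of powers instead of a logarithm.
  For distance 0 the inequality would say \<open>H + m \<le> n\<close>, which fails for the tree on two vertices.
\<close>
lemma centroid_center_dist_le:
  assumes deg: "\<And>v. v \<in> V \<Longrightarrow> degree v \<le> Suc q"
    and H: "(\<Sum>i<H. q ^ i) < card V div 2 + 1"
    and pos: "set_tdist T (centroid T) (center T) \<noteq> 0"
  shows "2 * set_tdist T (centroid T) (center T) + H + (card V div 2 + 1) \<le> card V"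
proof -
  obtain u v where uv: "u \<in> centroid T" "v \<in> center T"
      "set_tdist T (centroid T) (center T) = d u v"
    and least: "\<And>u' v'. u' \<in> centroid T \<Longrightarrow> v' \<in> center T \<Longrightarrow> d u v \<le> d u' v'"
    using set_tdist_attained by blast
  have V: "u \<in> V" "v \<in> V" using uv by (auto simp: centroid_def center_def)
  have "u \<noteq> v" using pos uv V dist_self by auto
  obtain u' where u': "(u, u') \<in> parcs T" "u' \<in> V" "d u v = Suc (d u' v)"
    using ex_closer V \<open>u \<noteq> v\<close> by metis
  obtain v' where v': "(v, v') \<in> parcs T" "v' \<in> V" "d v u = Suc (d v' u)"
    using ex_closer V \<open>u \<noteq> v\<close> by metis
  have uv_side: "v \<in> side u' u" "u \<in> side v' v"
    using u' v' V by (auto simp: side_def)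
  \<comment> \<open>The component of \<open>u\<close> is the larger one, and deep.\<close>
  have "u' \<notin> centroid T" using least[of u' v] uv u' by auto
  then have "vertex_dist T u < vertex_dist T u'"
    using uv(1) u'(2) by (force simp: centroid_def not_le)
  then have "card (side u' u) < card (side u u')"
    using vertex_dist_side[OF u'(1)] by simp
  then have large: "card V div 2 + 1 \<le> card (side u u')"
    and small: "card (side u' u) + (card V div 2 + 1) \<le> card V"
    using card_side_add[OF u'(1)] by auto
  obtain w where w: "w \<in> side u u'" "H \<le> d w u"
    using ex_far_in_side[OF u'(1) deg] H large by (metis le_trans not_le)
  \<comment> \<open>An eccentric vertex of \<open>v'\<close> lies behind \<open>v\<close>.\<close>
  have "v' \<notin> center T"
    using least[of u v'] uv v' V dist_commute by auto
  then have "ecc T v < ecc T v'"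
    using uv(2) v'(2) by (force simp: center_def not_le)
  moreover obtain x where x: "x \<in> V" "d v' x = ecc T v'" by (rule ex_ecc)
  moreover have "d v x \<le> ecc T v" using x dist_le_ecc by simp
  ultimately have x': "x \<in> side v v'" "d v x = ecc T v"
    using dist_adjacent[OF v'(1) x(1)] by (auto simp: side_def)
  have ux: "d u x = d u v' + 1 + d v x"
    using dist_across_edge[OF arcs_symmetric[OF v'(1)] x'(1) uv_side(2)] .
  have wv: "d w v = d w u + 1 + d u' v"
    using dist_across_edge[OF u'(1) uv_side(1) w(1)] .
  have wV: "w \<in> V" using w in_sideD by auto
  have "d w v \<le> ecc T v" using dist_le_ecc[OF wV, of v] dist_commute wV V by simp
  moreover have "d u v' = d v' u" "d u v = d v u" using dist_commute V v' by auto
  moreover have "d u' x \<le> d u' v + d v x" using dist_triangle V u' x by auto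
  ultimately have xu: "d u x = d u v + ecc T v" "x \<in> side u' u"
    using ux x' v' u' x by (auto simp: side_def)
  have "d x u' < card (side u' u)"
    using dist_less_card_side[OF arcs_symmetric[OF u'(1)] xu(2)] .
  moreover have "d x u' = d u' x" using dist_commute x u' by auto
  moreover have "d u x = Suc (d u' x)" using side_dist[OF arcs_symmetric[OF u'(1)] xu(2)] .
  ultimately have "d u v + ecc T v \<le> card (side u' u)" using xu by simp
  moreover have "d u v + H \<le> ecc T v"
    using wv w u' \<open>d w v \<le> ecc T v\<close> by simp
  ultimately show ?thesis using small uv by simp
qed

end

section \<open>Trees given by a parent function\<close>

lemma pcas_append: "pcas u (p @ q) v \<longleftrightarrow> (\<exists>w. pcas u p w \<and> pcas w q v)"
  by (induction p arbitrary: u) auto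

lemma pcas_last: "pcas u p v \<Longrightarrow> p \<noteq> [] \<Longrightarrow> snd (last p) = v"
  by (induction p arbitrary: u) (auto split: if_splits)

definition parent_graph :: "nat \<Rightarrow> (nat \<Rightarrow> nat) \<Rightarrow> nat pair_pre_digraph" where
  "parent_graph n par =
     \<lparr> pverts = {..<n}, parcs = {(par j, j) | j. 0 < j \<and> j < n} \<union> {(j, par j) | j. 0 < j \<and> j < n} \<rparr>"

lemma pverts_parent_graph [simp]: "pverts (parent_graph n par) = {..<n}"
  by (simp add: parent_graph_def)

lemma parcs_parent_graph:
  "(x, y) \<in> parcs (parent_graph n par) \<longleftrightarrow>
     0 < y \<and> y < n \<and> x = par y \<or> 0 < x \<and> x < n \<and> y = par x"
  by (auto simp: parent_graph_def)

text \<open>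
  Both neighbours of the largest vertex \<open>M\<close> of a cycle are smaller than \<open>M\<close>, so both are its parent.  Hence
  they coincide, which a cycle of length at least 3 does not permit.  The cases distinguish whether
  \<open>M\<close> or its predecessor is the vertex at which the closed walk is cut open.
\<close>
lemma cycle_free_parent_graph:
  assumes par: "\<And>j. 0 < j \<Longrightarrow> j < n \<Longrightarrow> par j < j"
    and walk: "pcas u c u" "set c \<subseteq> parcs (parent_graph n par)"
    and dist: "distinct (map snd c)" and len: "3 \<le> length c"
  shows False
proof -
  define M where "M = Max (set (map snd c))"
  have "M \<in> set (map snd c)"
    unfolding M_def using len by (intro Max_in) auto
  then obtain x where "(x, M) \<in> set c" by auto
  then obtain c1 c2 where c: "c = c1 @ (x, M) # c2" by (meson split_list)
  have max: "y \<le> M" if "y \<in> set (map snd c)" for y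
    unfolding M_def using that by (intro Max_ge) auto
  have nbr: "y = par M"
    if "(y, M) \<in> parcs (parent_graph n par) \<or> (M, y) \<in> parcs (parent_graph n par)"
      and "y \<in> set (map snd c)" for y
    using that(1) max[OF that(2)] par[of y] par[of M] unfolding parcs_parent_graph by fastforce
  obtain w1 where w1: "pcas u c1 w1" "pcas w1 ((x, M) # c2) u"
    using walk(1) unfolding c pcas_append by blast
  then have w: "w1 = x" "pcas M c2 u" by auto
  show False
  proof (cases c2)
    case Nil
    then have "u = M" using w by simp
    have "c1 \<noteq> []" using len c Nil by auto
    then obtain y c1' where c1: "c1 = (u, y) # c1'"
      using w1(1) by (cases c1) auto
    have "c1' \<noteq> []" using len c Nil c1 by auto
    then have x: "x \<in> set (map snd c1')"
      using pcas_last[OF w1(1)] w c1 last_in_set[of c1'] by force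
    then have "x = par M" "y = par M"
      using nbr[of x] nbr[of y] walk(2) c c1 \<open>u = M\<close> by auto
    then show False using x dist c c1 by auto
  next
    case (Cons e c3)
    then obtain y where c2: "c2 = (M, y) # c3" using w by (cases e) auto
    have y: "y = par M"
      using nbr[of y] walk(2) c c2 by auto
    show False
    proof (cases "c1 = []")
      case False
      then have x: "x \<in> set (map snd c1)"
        using pcas_last[OF w1(1)] w last_in_set[of c1] by force
      then have "x = par M" using nbr[of x] walk(2) c by auto
      then show False using x y dist c c2 by auto
    next
      case True
      then have "u = x" using w1 w by simp
      have "c3 \<noteq> []" using len c c2 True by auto
      then have x: "x \<in> set (map snd c3)"
        using pcas_last[OF w(2)] c2 last_in_set[of c3] \<open>u = x\<close> by force
      then have "x = par M" using nbr[of x] walk(2) c c2 by auto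
      then show False using x y dist c c2 by auto
    qed
  qed
qed

locale parent_tree =
  fixes n :: nat and par :: "nat \<Rightarrow> nat"
  assumes n_pos: "0 < n" and par_less: "0 < j \<Longrightarrow> j < n \<Longrightarrow> par j < j"
begin

lemma pair_graph_parent_graph: "pair_graph (parent_graph n par)"
proof
  show "fst e \<in> pverts (parent_graph n par)" "snd e \<in> pverts (parent_graph n par)"
    "fst e \<noteq> snd e"
    if "e \<in> parcs (parent_graph n par)" for e
    using that par_less[of "fst e"] par_less[of "snd e"]
    by (cases e; auto simp: parcs_parent_graph)+
  have "(x, y) \<in> {..<n} \<times> {..<n}" if "(x, y) \<in> parcs (parent_graph n par)" for x y
    using that par_less[of x] par_less[of y] by (auto simp: parcs_parent_graph)
  then have "parcs (parent_graph n par) \<subseteq> {..<n} \<times> {..<n}"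
    by auto
  then show "finite (parcs (parent_graph n par))"
    by (rule finite_subset) simp
  show "symmetric (with_proj (parent_graph n par))"
    by (auto simp: symmetric_def sym_def parcs_parent_graph)
qed simp

lemma utree_parent_graph: "utree (parent_graph n par)"
proof -
  let ?T = "parent_graph n par"
  interpret G: pair_graph ?T by (rule pair_graph_parent_graph)
  have "\<not> (\<exists>c. G.cycle c \<and> 3 \<le> length c)"
  proof
    assume "\<exists>c. G.cycle c \<and> 3 \<le> length c"
    then obtain c u where c: "3 \<le> length c" "G.awalk u c u" "distinct (tl (G.awalk_verts u c))"
      by (auto simp: G.cycle_def)
    have "distinct (map snd c)" "pcas u c u" "set c \<subseteq> parcs ?T"
      using c G.awalk_verts_conv'[of u c u] by (auto simp: G.awalk_def split: if_splits)
    then show False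
      using cycle_free_parent_graph par_less c(1) by blast
  qed
  moreover have "connected ?T"
  proof -
    have root: "x \<rightarrow>\<^sup>*\<^bsub>?T\<^esub> 0" if "x < n" for x
      using that
    proof (induction x rule: less_induct)
      case (less x)
      show ?case
      proof (cases "x = 0")
        case True
        then show ?thesis using n_pos by simp
      next
        case False
        then have "(x, par x) \<in> parcs ?T" "par x \<rightarrow>\<^sup>*\<^bsub>?T\<^esub> 0"
          using less par_less[of x] by (auto simp: parcs_parent_graph)
        then show ?thesis by (rule G.adj_reachable_trans)
      qed
    qed
    then have "x \<rightarrow>\<^sup>*\<^bsub>?T\<^esub> y" if "x < n" "y < n" for x y
      using that G.reachable_trans G.symmetric_reachable' by metis
    then show ?thesis
      using n_pos G.reachable_mk_symmetricI unfolding connected_def strongly_connected_def by auto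
  qed
  ultimately show ?thesis using pair_graph_parent_graph by (simp add: utree_def)
qed

end

sublocale parent_tree \<subseteq> undirected_tree "parent_graph n par"
  using utree_parent_graph by unfold_locales

context parent_tree
begin

lemma arc_par: "0 < j \<Longrightarrow> j < n \<Longrightarrow> (j, par j) \<in> parcs (parent_graph n par)"
  by (simp add: parcs_parent_graph)

text \<open>
  The only edge leaving the component of \<open>j\<close> is the one to its parent.  So this component, the subtree below
  \<open>j\<close>, is found by following parents, without describing any path.
\<close>
lemma par_in_side_iff:
  assumes j: "0 < j" "j < n" and x: "0 < x" "x < n" "x \<noteq> j"
  shows "par x \<in> side j (par j) \<longleftrightarrow> x \<in> side j (par j)"
proof -
  have V: "x \<in> V" "par x \<in> V" using x par_less[of x] by auto
  have no: "\<not> (a \<in> side j (par j) \<and> b \<in> side (par j) j)"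
    if "(a, b) \<in> parcs (parent_graph n par)" "(a, b) = (x, par x) \<or> (a, b) = (par x, x)" for a b
  proof
    assume "a \<in> side j (par j) \<and> b \<in> side (par j) j"
    then have "a = j \<and> b = par j" using crossing_arc arc_par j that(1) by blast
    then show False using that(2) x par_less[of x] par_less[of j] j by auto
  qed
  show ?thesis
    using no[of x "par x"] no[of "par x" x] arc_par[OF x(1,2)] arcs_symmetric V
      not_side_iff[OF arc_par[OF j]] by blast
qed

lemma smaller_not_in_side:
  assumes j: "0 < j" "j < n" and x: "x < j"
  shows "x \<notin> side j (par j)"
proof -
  have root: "y \<in> side j (par j) \<longleftrightarrow> 0 \<in> side j (par j)" if "y < j" for y
    using that
  proof (induction y rule: less_induct)
    case (less y)
    show ?case
    proof (cases "y = 0")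
      case False
      then have "par y < y" "y \<noteq> j" "0 < y" "y < n" using par_less[of y] less.prems j by auto
      then show ?thesis
        using par_in_side_iff[OF j, of y] less.IH[of "par y"] less.prems by simp
    qed simp
  qed
  have "par j \<notin> side j (par j)"
    using end_in_side[OF arcs_symmetric[OF arc_par[OF j]]] side_Int by blast
  then show ?thesis using root x par_less[OF j] by blast
qed

lemma dist_root: "0 < j \<Longrightarrow> j < n \<Longrightarrow> d 0 j = Suc (d 0 (par j))"
proof -
  assume j: "0 < j" "j < n"
  have "0 \<in> side (par j) j"
    using smaller_not_in_side[OF j j(1)] not_side_iff[OF arc_par[OF j]] n_pos by simp
  then have "d j 0 = Suc (d (par j) 0)"
    using side_dist[OF arcs_symmetric[OF arc_par[OF j]]] by simp
  then show ?thesis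
    using dist_commute[of 0] j par_less[OF j] n_pos by simp
qed

lemma vertex_dist_par_less:
  assumes "0 < j" "j < n" "2 * card (side j (par j)) < n"
  shows "vertex_dist (parent_graph n par) (par j) < vertex_dist (parent_graph n par) j"
  using vertex_dist_side[OF arc_par[OF assms(1,2)]] card_side_add[OF arc_par[OF assms(1,2)]] assms
  by simp

end

section \<open>The extremal tree\<close>

text \<open>
  The extremal tree, described directly by its parent function: vertices below \<open>m\<close> form a \<open>q\<close>-ary
  tree numbered level by level, the others a path of \<open>l\<close> edges attached to the root \<open>0\<close>.  The condition \<open>q < m\<close>
  means that the root has \<open>q\<close> children besides the first vertex of the path, hence degree \<open>k\<close>.
\<close>
locale broom_tree =
  fixes n q :: nat
  assumes q_ge: "2 \<le> q" and q_less: "q < n div 2 + 1"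
begin

definition m :: nat where "m = n div 2 + 1"
definition l :: nat where "l = n - m"

definition par :: "nat \<Rightarrow> nat" where
  "par j = (if j < m then (j - 1) div q else if j = m then 0 else j - 1)"

lemma bounds: "q < m" "3 \<le> m" "m < n" "n = m + l" "0 < l" "n < 2 * m" "m \<le> l + 2"
  using q_ge q_less by (auto simp: m_def l_def)

lemma par_less: "0 < j \<Longrightarrow> par j < j"
  using bounds le_less_trans[OF div_le_dividend, of "j - 1" j q] by (auto simp: par_def)

end

sublocale broom_tree \<subseteq> parent_tree n par
  using bounds par_less by unfold_locales auto

context broom_tree
begin

abbreviation "T \<equiv> parent_graph n par"

text \<open>
  The whole path has only \<open>l < n / 2\<close> vertices.  A branch in the \<open>q\<close>-ary part misses the root and, as \<open>q \<ge> 2\<close>,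
  at least one child of the root, which leaves at most \<open>m - 2 < n / 2\<close> vertices.
\<close>
lemma side_small:
  assumes j: "0 < j" "j < n"
  shows "2 * card (side j (par j)) < n"
proof (cases "j < m")
  case False
  have "side j (par j) \<subseteq> {m..<n}"
    using smaller_not_in_side[OF j] False in_sideD by (auto simp: not_less[symmetric])
  then have "card (side j (par j)) \<le> l"
    using card_mono[of "{m..<n}"] by (simp add: l_def)
  then show ?thesis using bounds by linarith
next
  case True
  have zero: "0 \<notin> side j (par j)" using smaller_not_in_side[OF j j(1)] .
  have path: "x \<notin> side j (par j)" if "m \<le> x" "x < n" for x
    using that
  proof (induction x rule: less_induct)
    case (less x)
    then have x: "0 < x" "x < n" "x \<noteq> j" using True by auto
    have "par x = 0 \<or> m \<le> par x \<and> par x < x \<and> par x < n"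
      using less.prems by (auto simp: par_def)
    then have "par x \<notin> side j (par j)"
      using zero less.IH by metis
    then show ?case using par_in_side_iff[OF j x] by simp
  qed
  \<comment> \<open>a child of the root that is not \<open>j\<close>\<close>
  define c where "c = (if j = 1 then 2 else 1 :: nat)"
  have c: "0 < c" "c < n" "c \<noteq> j" "c < m" using bounds by (auto simp: c_def)
  have "par c = 0" using q_ge c by (auto simp: par_def c_def)
  then have "c \<notin> side j (par j)" using par_in_side_iff[OF j c(1-3)] zero by simp
  moreover have "x < m" if "x \<in> side j (par j)" for x
    using path[of x] in_sideD[OF that] that by (cases "x < m") auto
  ultimately have "side j (par j) \<subseteq> {..<m} - {0, c}"
    using zero by blast
  then have "card (side j (par j)) \<le> card ({..<m} - {0, c})"
    by (rule card_mono[rotated]) simp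
  also have "\<dots> = m - 2" using c bounds by (simp add: card_Diff_subset)
  finally show ?thesis using bounds by (auto simp: m_def)
qed

lemma centroid_eq: "centroid T = {0}"
proof -
  have "u = 0" if "u \<in> centroid T" for u
  proof (rule ccontr)
    assume "u \<noteq> 0"
    then have u: "0 < u" "u < n" using that by (auto simp: centroid_def)
    then have "vertex_dist T (par u) < vertex_dist T u"
      using vertex_dist_par_less side_small by blast
    moreover have "par u \<in> V" using u par_less[of u] by auto
    ultimately show False using that by (auto simp: centroid_def not_less[symmetric])
  qed
  then show ?thesis using centroid_nonempty by blast
qed

text \<open>
  The first \<open>h + 1\<close> levels of a complete \<open>q\<close>-ary tree have \<open>\<Sum>t\<le>h. q ^ t\<close> vertices, and dividing
  \<open>i - 1\<close> by \<open>q\<close> passes from each level to the one before.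
\<close>
lemma dist_root_le:
  assumes "i < m" "i < (\<Sum>t<Suc h. q ^ t)"
  shows "d 0 i \<le> h"
  using assms
proof (induction h arbitrary: i)
  case 0
  then show ?case using dist_self n_pos by simp
next
  case (Suc h)
  show ?case
  proof (cases "i = 0")
    case True
    then show ?thesis using dist_self n_pos by simp
  next
    case False
    have "i < 1 + q * (\<Sum>t<Suc h. q ^ t)"
      using Suc.prems(2) by (subst (asm) sum.lessThan_Suc_shift) (simp add: sum_distrib_left del: sum.lessThan_Suc)
    then have "i - 1 < (\<Sum>t<Suc h. q ^ t) * q"
      using False by (simp add: mult.commute del: sum.lessThan_Suc)
    then have "(i - 1) div q < (\<Sum>t<Suc h. q ^ t)"
      by (rule less_mult_imp_div_less)
    moreover have "par i = (i - 1) div q" using Suc.prems by (simp add: par_def)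
    ultimately have "d 0 (par i) \<le> h"
      using Suc.IH[of "par i"] Suc.prems par_less[of i] False by simp
    then show ?thesis using dist_root[of i] False Suc.prems bounds by simp
  qed
qed

lemma path_vertex_less: "i \<le> l \<Longrightarrow> path_vertex m i < n"
  using bounds by (auto simp: path_vertex_def)

lemma par_path_vertex: "i < l \<Longrightarrow> par (path_vertex m (Suc i)) = path_vertex m i"
  by (auto simp: path_vertex_def par_def)

lemma dist_root_path: "i \<le> l \<Longrightarrow> d 0 (path_vertex m i) = i"
proof (induction i)
  case 0
  then show ?case using dist_self n_pos by (simp add: path_vertex_def)
next
  case (Suc i)
  have "0 < path_vertex m (Suc i)" using bounds by (simp add: path_vertex_def)
  then show ?case
    using Suc dist_root[of "path_vertex m (Suc i)"] path_vertex_less[of "Suc i"] par_path_vertex[of i]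
    by simp
qed

lemma dist_path_le: "i \<le> j \<Longrightarrow> j \<le> l \<Longrightarrow> d (path_vertex m i) (path_vertex m j) \<le> j - i"
proof (induction j)
  case 0
  then show ?case using dist_self path_vertex_less by simp
next
  case (Suc j)
  show ?case
  proof (cases "i = Suc j")
    case True
    then show ?thesis using dist_self path_vertex_less Suc.prems by simp
  next
    case False
    then have ij: "i \<le> j" "j < l" using Suc.prems by auto
    have "0 < path_vertex m (Suc j)" using bounds by (simp add: path_vertex_def)
    then have "(path_vertex m j, path_vertex m (Suc j)) \<in> parcs T"
      using par_path_vertex[OF ij(2)] path_vertex_less[of "Suc j"] ij by (auto simp: parcs_parent_graph)
    then have "d (path_vertex m j) (path_vertex m (Suc j)) = 1" by (rule dist_arc)
    then show ?thesis
      using dist_triangle[of "path_vertex m i" "path_vertex m j" "path_vertex m (Suc j)"]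
        path_vertex_less Suc.IH ij by fastforce
  qed
qed

lemma vertex_cases:
  assumes "x < n"
  obtains "x < m" | i where "0 < i" "i \<le> l" "x = path_vertex m i"
proof (cases "x < m")
  case False
  then have "0 < x - m + 1" "x - m + 1 \<le> l" "x = path_vertex m (x - m + 1)"
    using assms bounds by (auto simp: path_vertex_def)
  then show ?thesis by (rule that(2))
qed (rule that(1))

text \<open>
  Compare \<open>v\<close> with the vertex \<open>w\<close> of the path at distance \<open>D = (l - H) div 2\<close> from the root.  The
  eccentricity of \<open>w\<close> is at most \<open>l - D\<close>: the \<open>q\<close>-ary part is within \<open>D + H \<le> l - D\<close>.  But the free end
  \<open>e\<close> of the path is further than \<open>l - D\<close> from any vertex closer than \<open>D\<close> to the root.
\<close>
lemma center_far:
  assumes H: "m \<le> (\<Sum>t<Suc H. q ^ t)" "H \<le> l" and v: "v \<in> center T"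
  shows "(l - H) div 2 \<le> d 0 v"
proof (rule ccontr)
  define D where "D = (l - H) div 2"
  define w where "w = path_vertex m D"
  define e where "e = path_vertex m l"
  assume "\<not> (l - H) div 2 \<le> d 0 v"
  then have less: "d 0 v < D" by (simp add: D_def)
  have D: "2 * D + H \<le> l" using H by (auto simp: D_def)
  have V: "0 \<in> V" "v \<in> V" "e \<in> V" "w \<in> V"
    using n_pos v path_vertex_less D by (auto simp: center_def e_def w_def)
  have "l \<le> d 0 v + d v e"
    using dist_triangle[OF V(1-3)] dist_root_path[of l] by (simp add: e_def)
  then have far: "l - D < ecc T v"
    using dist_le_ecc[OF V(3), of v] less D by simp
  obtain x where x: "x \<in> V" "d w x = ecc T w" by (rule ex_ecc)
  have "x < n" using x by simp
  then have "d w x \<le> l - D"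
  proof (cases rule: vertex_cases)
    case 1
    then have "d 0 x \<le> H" using dist_root_le H by simp
    moreover have "d w 0 = D" using dist_commute[OF V(4,1)] dist_root_path[of D] D by (simp add: w_def)
    ultimately show ?thesis using dist_triangle[OF V(4,1) x(1)] D by simp
  next
    case (2 i)
    show ?thesis
    proof (cases "D \<le> i")
      case True
      then show ?thesis using dist_path_le[of D i] 2 by (simp add: w_def)
    next
      case False
      then have "d x w \<le> D - i" using dist_path_le[of i D] 2 D by (simp add: w_def)
      then show ?thesis using dist_commute[OF V(4) x(1)] D by simp
    qed
  qed
  then have "ecc T w < ecc T v" using x far by simp
  then show False using v V by (auto simp: center_def not_less[symmetric])
qed

lemma set_tdist_ge:
  assumes H: "m \<le> (\<Sum>t<Suc H. q ^ t)" "H \<le> l"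
  shows "(l - H) div 2 \<le> set_tdist T (centroid T) (center T)"
  using set_tdist_attained center_far[OF H] centroid_eq by (metis singletonD)

lemma degree_le: "degree v \<le> Suc q"
proof -
  let ?N = "{w. (v, w) \<in> parcs T}"
  consider "v = 0" | "0 < v" "v < m" | "m \<le> v" by linarith
  then show ?thesis
  proof cases
    case 1
    have "?N \<subseteq> insert m {1..q}"
    proof
      fix w assume "w \<in> ?N"
      then have w: "0 < w" "par w = 0" using 1 by (auto simp: parcs_parent_graph)
      then show "w \<in> insert m {1..q}"
        using q_ge bounds by (auto simp: par_def div_eq_0_iff split: if_splits)
    qed
    then have "card ?N \<le> card (insert m {1..q})" by (rule card_mono[rotated]) simp
    then show ?thesis using bounds by (simp add: degree_eq)
  next
    case 2
    have "?N \<subseteq> insert (par v) {q * v + 1..q * v + q}"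
    proof
      fix w assume "w \<in> ?N"
      then consider "w = par v" | "0 < w" "v = par w" by (auto simp: parcs_parent_graph)
      then show "w \<in> insert (par v) {q * v + 1..q * v + q}"
      proof cases
        case b: 2
        then have "w < m" using 2 by (auto simp: par_def split: if_splits)
        then have v: "v = (w - 1) div q" using b by (simp add: par_def)
        have "w - 1 = q * v + (w - 1) mod q" unfolding v by simp
        moreover have "(w - 1) mod q < q" using q_ge by simp
        ultimately show ?thesis using b(1) by auto
      qed simp
    qed
    then have "card ?N \<le> card (insert (par v) {q * v + 1..q * v + q})"
      by (rule card_mono[rotated]) simp
    also have "\<dots> \<le> Suc q" by (simp add: card_insert_if)
    finally show ?thesis by (simp add: degree_eq)
  next
    case 3
    have "?N \<subseteq> {par v, Suc v}"
    proof
      fix w assume "w \<in> ?N"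
      then consider "w = par v" | "0 < w" "v = par w" by (auto simp: parcs_parent_graph)
      then show "w \<in> {par v, Suc v}"
      proof cases
        case 2
        have "\<not> w < m" using par_less[OF 2(1)] 2(2) 3 by simp
        then show ?thesis using 2 3 bounds by (auto simp: par_def split: if_splits)
      qed simp
    qed
    then have "card ?N \<le> card {par v, Suc v}" by (rule card_mono[rotated]) simp
    also have "\<dots> \<le> 2" by (simp add: card_insert_if)
    finally show ?thesis using q_ge by (simp add: degree_eq)
  qed
qed

lemma degree_root: "degree 0 = Suc q"
proof -
  have "insert m {1..q} \<subseteq> {w. (0, w) \<in> parcs T}"
    using bounds by (auto simp: parcs_parent_graph par_def)
  then have "card (insert m {1..q}) \<le> degree 0"
    unfolding degree_eq by (rule card_mono[OF finite_neighbours])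
  then show ?thesis using degree_le[of 0] bounds by simp
qed

lemma max_degree_eq: "max_degree T = Suc q"
  unfolding max_degree_def
proof (rule Max_eqI)
  show "Suc q \<in> degree ` pverts T"
    using degree_root n_pos by (metis image_eqI lessThan_iff pverts_parent_graph)
qed (use degree_le in auto)

end

section \<open>Extended rgood trees\<close>

text \<open>
  In the numbering of the greedy tree the vertices \<open>0, \<dots>, a\<close> have \<open>q\<close> children, vertex \<open>a + 1\<close> has
  \<open>s - 1 < q\<close> and all others none.  As the condition on the degree sum says
  \<open>m = 1 + (a + 1) * q + (s - 1)\<close>, this exhausts the vertices, and the children of \<open>i\<close> are those
  \<open>j < m\<close> with \<open>i * q < j \<le> i * q + q\<close>.
\<close>
lemma extended_rgood_arcs:
  assumes R: "extended_rgood m (Suc q) R" and q: "2 \<le> q"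
  shows "q < m" "pverts R = {..<m}"
    "parcs R = {(i, j). 0 < j \<and> j < m \<and> i = (j - 1) div q} \<union> {(j, i). 0 < j \<and> j < m \<and> i = (j - 1) div q}"
proof -
  obtain a b s ds where s: "1 \<le> s" "s < Suc q"
    and ds: "ds = replicate a (Suc q) @ [q, s] @ replicate b 1"
    and m: "length ds = m" "sum_list ds = 2 * (m - 1)" and R: "R = rooted_greedy_tree ds q"
    using R unfolding extended_rgood_def by auto
  have m_eq: "m = a + b + 2" using m(1) ds by simp
  have "a * Suc q + q + s + b = 2 * (m - 1)"
    using m(2) unfolding ds by (simp add: sum_list_replicate)
  then have size: "m = 1 + (a + 1) * q + (s - 1)"
    using m_eq s by (simp add: algebra_simps)
  show "q < m" using size by (simp add: algebra_simps)
  show "pverts R = {..<m}" using R m by (simp add: rooted_greedy_tree_def)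
  have rest: "remove1 q ds = replicate a (Suc q) @ s # replicate b 1"
    by (simp add: ds remove1_append)
  have children: "greedy_children ds q i = (if i \<le> a then q else if i = Suc a then s - 1 else 0)"
    if "i < m" for i
  proof -
    consider "i = 0" | "0 < i" "i \<le> a" | "i = Suc a" | "Suc a < i" by linarith
    then show ?thesis
    proof cases
      case 4
      then have "(s # replicate b 1) ! (i - 1 - a) = 1"
        using that m_eq by (cases "i - 1 - a") auto
      moreover have "\<not> i - 1 < a" using 4 by simp
      ultimately show ?thesis using 4 by (simp add: greedy_children_def rest nth_append)
    qed (auto simp: greedy_children_def rest nth_append)
  qed
  have first: "greedy_first_child ds q i = 1 + i * q" if "i \<le> Suc a" for i
  proof -
    have "(\<Sum>j<i. greedy_children ds q j) = (\<Sum>j<i. q)"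
      using that m_eq children by (intro sum.cong) auto
    then show ?thesis by (simp add: greedy_first_child_def)
  qed
  have div: "i = (j - 1) div q \<longleftrightarrow> i * q \<le> j - 1 \<and> j - 1 < i * q + q" for i j
  proof
    assume "i = (j - 1) div q"
    moreover have "j - 1 = (j - 1) div q * q + (j - 1) mod q" by simp
    moreover have "(j - 1) mod q < q" using q by simp
    ultimately show "i * q \<le> j - 1 \<and> j - 1 < i * q + q" by (metis le_add1 add_less_cancel_left)
  next
    assume "i * q \<le> j - 1 \<and> j - 1 < i * q + q"
    then show "i = (j - 1) div q" by (intro div_nat_eqI[symmetric]) (auto simp: mult.commute)
  qed
  have "(i, j) \<in> greedy_edges ds q \<longleftrightarrow> 0 < j \<and> j < m \<and> i = (j - 1) div q" for i j
  proof -
    have edge: "(i, j) \<in> greedy_edges ds q \<longleftrightarrow> i < m \<and> greedy_first_child ds q i \<le> j \<and>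
        j < greedy_first_child ds q i + greedy_children ds q i"
      by (simp add: greedy_edges_def m)
    consider "i \<le> a" | "i = Suc a" | "Suc a < i" by linarith
    then show ?thesis
    proof cases
      case 1
      then have "i * q + q \<le> (a + 1) * q" using mult_le_mono1[of "Suc i" "Suc a" q] by simp
      then have "j < m" if "j < 1 + i * q + q" using that size by linarith
      then show ?thesis
        using 1 m_eq unfolding edge div by (auto simp: first children)
    next
      case 2
      then show ?thesis
        using size m_eq s unfolding edge div by (auto simp: first children)
    next
      case 3
      have "(a + 1) * q + q \<le> i * q" using mult_le_mono1[of "Suc (Suc a)" i q] 3 by simp
      then have "\<not> (j < m \<and> i * q \<le> j - 1)" using size s by linarith
      then show ?thesis
        using 3 unfolding edge div by (auto simp: children)
    qed
  qed
  then show "parcs R = {(i, j). 0 < j \<and> j < m \<and> i = (j - 1) div q} \<union> {(j, i). 0 < j \<and> j < m \<and> i = (j - 1) div q}"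
    by (auto simp: R rooted_greedy_tree_def)
qed

text \<open>
  The condition \<open>m - 1 = (a + 1) * q + (s - 1)\<close> on the degree sum is division with remainder.
\<close>
lemma extended_rgood_exists:
  assumes "3 \<le> k" "k \<le> m"
  shows "\<exists>R. extended_rgood m k R"
proof -
  define q where "q = k - 1"
  have q: "k = Suc q" "2 \<le> q" "q \<le> m - 1" using assms by (auto simp: q_def)
  define a where "a = (m - 1) div q - 1"
  define s where "s = Suc ((m - 1) mod q)"
  define b where "b = m - 2 - a"
  have "0 < (m - 1) div q" using q by (simp add: div_greater_zero_iff)
  then have a: "Suc a = (m - 1) div q" by (simp add: a_def)
  have decomp: "m - 1 = Suc a * q + (s - 1)" by (simp add: a s_def)
  have "a + 2 \<le> m" using a div_le_dividend[of "m - 1" q] assms by linarith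
  then have b: "a + b + 2 = m" by (simp add: b_def)
  have "a * Suc q + q + s + b = 2 * (m - 1)"
    using decomp b by (simp add: s_def)
  moreover have "1 \<le> s" "s < k" using q by (auto simp: s_def)
  ultimately show ?thesis
    unfolding extended_rgood_def using b q
    by (intro exI[of _ "rooted_greedy_tree (replicate a k @ [k - 1, s] @ replicate b 1) (k - 1)"]
        exI[of _ a] exI[of _ b] exI[of _ s] exI[of _ "replicate a k @ [k - 1, s] @ replicate b 1"])
      (auto simp: sum_list_replicate)
qed

lemma (in broom_tree) attach_path_eq:
  assumes "extended_rgood m (Suc q) R"
  shows "attach_path R (n - m) = parent_graph n par"
proof -
  note R = extended_rgood_arcs[OF assms q_ge]
  have order: "order R = m" by (simp add: order_def R)
  have "path_vertex m ` {..l} = insert 0 {m..<n}"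
  proof
    show "path_vertex m ` {..l} \<subseteq> insert 0 {m..<n}"
      using bounds by (auto simp: path_vertex_def)
    show "insert 0 {m..<n} \<subseteq> path_vertex m ` {..l}"
    proof
      fix x assume "x \<in> insert 0 {m..<n}"
      then consider "x = path_vertex m 0" | "x = path_vertex m (x - m + 1)" "x - m + 1 \<le> l"
        using bounds by (auto simp: path_vertex_def)
      then show "x \<in> path_vertex m ` {..l}" by cases auto
    qed
  qed
  then have verts: "{..<m} \<union> path_vertex m ` {..l} = {..<n}"
    using bounds by auto
  have path: "(i, j) \<in> path_edges m l \<longleftrightarrow> m \<le> j \<and> j < n \<and> i = par j" for i j
  proof
    assume "(i, j) \<in> path_edges m l"
    then show "m \<le> j \<and> j < n \<and> i = par j"
      using bounds by (auto simp: path_edges_def path_vertex_def par_def)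
  next
    assume j: "m \<le> j \<and> j < n \<and> i = par j"
    then have "j - m < l" "j = path_vertex m (Suc (j - m))" using bounds by (auto simp: path_vertex_def)
    moreover then have "i = path_vertex m (j - m)" using par_path_vertex j by metis
    ultimately show "(i, j) \<in> path_edges m l" unfolding path_edges_def by blast
  qed
  have "parcs R \<union> path_edges m l \<union> (path_edges m l)\<inverse> = parcs (parent_graph n par)"
  proof (intro set_eqI)
    fix e :: "nat \<times> nat"
    obtain x y where e: "e = (x, y)" by (cases e)
    have "(x, y) \<in> parcs R \<longleftrightarrow> 0 < y \<and> y < m \<and> x = par y \<or> 0 < x \<and> x < m \<and> y = par x"
      by (auto simp: R par_def)
    then show "e \<in> parcs R \<union> path_edges m l \<union> (path_edges m l)\<inverse> \<longleftrightarrow> e \<in> parcs (parent_graph n par)"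
      using bounds(2,3) by (auto simp: e path parcs_parent_graph)
  qed
  then show ?thesis
    using verts by (simp add: attach_path_def order R l_def[symmetric] parent_graph_def)
qed

section \<open>Arithmetic of the bound\<close>

lemma half_order_eq: "half_order n = int (n div 2 + 1)"
  unfolding half_order_def
proof (rule ceiling_unique)
  have "2 * (n div 2) \<le> n" "n \<le> 2 * (n div 2) + 1" by linarith+
  then have "2 * real (n div 2) \<le> real n" "real n \<le> 2 * real (n div 2) + 1"
    by linarith+
  then show "real_of_int (int (n div 2 + 1)) - 1 < (real n + 1) / 2"
    "(real n + 1) / 2 \<le> real_of_int (int (n div 2 + 1))"
    by simp_all
qed

lemma geometric_sum_Suc: "p * (\<Sum>i<N. Suc p ^ i) + 1 = Suc p ^ N"
  by (induction N) (auto simp: algebra_simps)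

text \<open>
  With the geometric sum \<open>(q - 1) * (\<Sum>i<N. q ^ i) + 1 = q ^ N\<close> the two inequalities become
  \<open>q ^ H < m * (q - 1) + 1 \<le> q ^ (H + 1)\<close>, which is what rounding up the logarithm says.
\<close>
lemma h_u_characterization:
  assumes q: "2 \<le> q"
  obtains H where "h_u n (Suc q) = int H" "(\<Sum>i<H. q ^ i) < n div 2 + 1"
    "n div 2 + 1 \<le> (\<Sum>i<Suc H. q ^ i)"
proof -
  define m where "m = n div 2 + 1"
  obtain p where p: "q = Suc p" "1 \<le> p" using q by (cases q) auto
  define X where "X = p * m + 1"
  have "real_of_int (half_order n) * (real (Suc q) - 2) + 1 = real X"
    unfolding half_order_eq m_def[symmetric] X_def p by (simp add: algebra_simps)
  moreover have "real (Suc q) - 1 = real q" by simp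
  ultimately have h: "h_u n (Suc q) = \<lceil>ln (real X) / ln (real q)\<rceil> - 1"
    unfolding h_u_def by (simp only:)
  have ln_q: "0 < ln (real q)" using q by simp
  have "q \<le> X" unfolding X_def p m_def by simp
  then have "1 \<le> ln (real X) / ln (real q)"
    using ln_q q by (simp add: le_divide_eq)
  then have "0 \<le> h_u n (Suc q)"
    unfolding h by linarith
  then obtain H where H: "h_u n (Suc q) = int H" using nonneg_int_cases by blast
  then have "real H < ln (real X) / ln (real q)" "ln (real X) / ln (real q) \<le> real H + 1"
    unfolding h by linarith+
  then have "real H * ln (real q) < ln (real X)" "ln (real X) \<le> real (Suc H) * ln (real q)"
    using ln_q by (simp_all add: field_simps)
  then have "ln (real q ^ H) < ln (real X)" "ln (real X) \<le> ln (real q ^ Suc H)"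
    using q by (simp_all only: ln_realpow)
  then have "real q ^ H < real X" "real X \<le> real q ^ Suc H"
    using q \<open>q \<le> X\<close> by (simp_all del: power_Suc)
  then have "q ^ H < X" "X \<le> q ^ Suc H"
    by (metis of_nat_less_iff of_nat_power, metis of_nat_le_iff of_nat_power)
  then have "p * (\<Sum>i<H. q ^ i) < p * m" "p * m \<le> p * (\<Sum>i<Suc H. q ^ i)"
    using geometric_sum_Suc[of p H] geometric_sum_Suc[of p "Suc H"] unfolding X_def p by linarith+
  then have "(\<Sum>i<H. q ^ i) < m" "m \<le> (\<Sum>i<Suc H. q ^ i)"
    using p(2) by (simp_all only: mult_less_cancel1 mult_le_cancel1)
  then show ?thesis
    using that[OF H] unfolding m_def by blast
qed

text \<open>
  This keeps the bound nonnegative: as \<open>m - 2 \<le> n - m\<close>, the attached path is at least as long as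
  the greedy tree is high.
\<close>
lemma height_le:
  assumes "2 \<le> q" "(\<Sum>i<H. q ^ i) < m" "3 \<le> m"
  shows "H + 2 \<le> (m :: nat)"
proof -
  have "2 * H \<le> (\<Sum>i<H. q ^ i) + 1"
  proof (induction H)
    case (Suc H)
    show ?case
    proof (cases H)
      case (Suc H')
      have "2 * 1 \<le> q * q ^ H'" using assms(1) by (intro mult_le_mono) auto
      then show ?thesis using Suc.IH Suc by simp
    qed simp
  qed simp
  then show ?thesis using assms by linarith
qed

lemma center_centroid_bound_eq:
  assumes "h_u n k = int H" "H + (n div 2 + 1) \<le> n"
  shows "center_centroid_bound n k = int ((n - (n div 2 + 1) - H) div 2)"
proof -
  have "int n - half_order n - h_u n k = int (n - (n div 2 + 1) - H)"
    using assms by (simp add: half_order_eq)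
  then have "center_centroid_bound n k = \<lfloor>real_of_int (int (n - (n div 2 + 1) - H)) / real_of_int 2\<rfloor>"
    unfolding center_centroid_bound_def by simp
  then show ?thesis unfolding floor_divide_of_int_eq by (simp add: zdiv_int)
qed

section \<open>The sharp bound\<close>

context undirected_tree
begin

lemma set_tdist_le_bound:
  assumes "3 \<le> max_degree T"
  shows "int (set_tdist T (centroid T) (center T)) \<le> center_centroid_bound (order T) (max_degree T)"
proof -
  obtain q where q: "max_degree T = Suc q" "2 \<le> q"
    using assms by (cases "max_degree T") auto
  let ?n = "order T" and ?D = "set_tdist T (centroid T) (center T)"
  obtain H where H: "h_u ?n (Suc q) = int H" "(\<Sum>i<H. q ^ i) < ?n div 2 + 1"
    using h_u_characterization[OF q(2)] by metis
  have "4 \<le> ?n" using max_degree_less_order assms by linarith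
  then have "H + 2 \<le> ?n div 2 + 1" using height_le[OF q(2) H(2)] by linarith
  then have Hn: "H + (?n div 2 + 1) \<le> ?n" by linarith
  have "2 * ?D + H + (?n div 2 + 1) \<le> ?n" if "?D \<noteq> 0"
    using centroid_center_dist_le[of q H] degree_le_max_degree q(1) H(2) that by (simp add: order_def)
  then have "?D \<le> (?n - (?n div 2 + 1) - H) div 2" by (cases "?D = 0") linarith+
  then show ?thesis unfolding q(1) center_centroid_bound_eq[OF H(1) Hn] by simp
qed

end

theorem theorem3p15:
  fixes n k :: nat
  assumes "n > 0" and "k \<ge> 3"
  shows
    "(\<forall>T :: 'a pair_pre_digraph. utree T \<and> order T = n \<and> max_degree T = k \<longrightarrow>
        int (set_tdist T (centroid T) (center T)) \<le> center_centroid_bound n k) \<and>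
     (let m = nat (half_order n) in
        (k \<le> m \<longrightarrow> (\<exists>R. extended_rgood m k R)) \<and>
        (\<forall>R T. extended_rgood m k R \<and> T = attach_path R (n - m) \<longrightarrow>
           utree T \<and> order T = n \<and> max_degree T = k \<and>
           int (set_tdist T (centroid T) (center T)) = center_centroid_bound n k))"
proof -
  have upper: "int (set_tdist T (centroid T) (center T)) \<le> center_centroid_bound n k"
    if "utree T" "order T = n" "max_degree T = k" for T :: "'b pair_pre_digraph"
    using undirected_tree.set_tdist_le_bound[of T] that assms(2) by (simp add: undirected_tree_def)
  define m where "m = nat (half_order n)"
  have m: "m = n div 2 + 1" by (simp add: m_def half_order_eq)
  obtain q where q: "k = Suc q" "2 \<le> q" using assms(2) by (cases k) auto
  have tight: "utree T \<and> order T = n \<and> max_degree T = k \<and>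
      int (set_tdist T (centroid T) (center T)) = center_centroid_bound n k"
    if R: "extended_rgood m k R" and T: "T = attach_path R (n - m)" for R T
  proof -
    have "q < m" using extended_rgood_arcs(1) R q by simp
    then interpret B: broom_tree n q using q m by unfold_locales simp_all
    have m': "B.m = m" by (simp add: B.m_def m)
    have T_eq: "T = parent_graph n B.par"
      using B.attach_path_eq R T q by (simp add: m')
    obtain H where H: "h_u n k = int H" "(\<Sum>i<H. q ^ i) < m" "m \<le> (\<Sum>i<Suc H. q ^ i)"
      using h_u_characterization[OF q(2)] unfolding q(1) m by metis
    have "H + 2 \<le> m" using height_le[OF q(2) H(2)] \<open>q < m\<close> q by linarith
    then have "H \<le> B.l" using B.bounds m' by linarith
    then have "(B.l - H) div 2 \<le> set_tdist T (centroid T) (center T)"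
      using B.set_tdist_ge H(3) unfolding T_eq m' by simp
    moreover have "H + (n div 2 + 1) \<le> n"
      using \<open>H \<le> B.l\<close> B.bounds m' m by linarith
    ultimately have "center_centroid_bound n k \<le> int (set_tdist T (centroid T) (center T))"
      using center_centroid_bound_eq[OF H(1)] by (simp add: B.l_def m' m)
    moreover have "utree T" "order T = n" "max_degree T = k"
      using B.utree B.max_degree_eq q by (simp_all add: T_eq order_def)
    ultimately show ?thesis using upper[of T] by simp
  qed
  show ?thesis
    unfolding Let_def m_def[symmetric]
    using upper tight extended_rgood_exists[OF assms(2)] by blast
qed

end
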